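(* For any digraph $D$ of order $n$ and any integer $k$ with $1\le k\le n-1$, $$\overleftrightarrow{\omega}(F_k(D))=\min\{\overleftrightarrow{\omega}(D),\ \max\{n-k+1,\,k+1\}\}.$$
   Context: A digraph $D$ has a finite vertex set $V(D)$ and a set $A(D)$ of arcs, which are ordered pairs of distinct vertices (both $(x,y)$ and $(y,x)$ may be arcs). For a digraph $D$ of order $n$ and $1 \le k \le n-1$, the $k$-token digraph $F_k(D)$ has as vertices all $k$-subsets of $V(D)$, and $(A,B)$ is an arc of $F_k(D)$ whenever $A\setminus B=\{a\}$, $B\setminus A=\{b\}$ and $(a,b)\in A(D)$. The complete digraph on $m$ vertices has both arcs $(x,y)$ and $(y,x)$ for every two distinct vertices $x,y$. A bidirected clique of a digraph is a complete subdigraph of it, and the bidirected clique number $\overleftrightarrow{\omega}(D)$ is the number of vertices of a largest bidirected clique of $D$. *)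

theory Defs
  imports "Graph_Theory.Graph_Theory"
begin

definition token_digraph :: "nat \<Rightarrow> 'a pair_pre_digraph \<Rightarrow> 'a set pair_pre_digraph" where
  "token_digraph k D =
     (let V = {A. A \<subseteq> pverts D \<and> card A = k} in
      \<lparr> pverts = V,
        parcs = {(A, B). A \<in> V \<and> B \<in> V \<and>
                   (\<exists>a b. A - B = {a} \<and> B - A = {b} \<and> (a, b) \<in> parcs D)} \<rparr>)"

definition bidirected_clique :: "'a pair_pre_digraph \<Rightarrow> 'a pair_pre_digraph \<Rightarrow> bool" where
  "bidirected_clique H D \<longleftrightarrow>
     subgraph (with_proj H) (with_proj D) \<and> (\<exists>m. complete_digraph m (with_proj H))"

(* The null digraph counts as a bidirected clique of order 0; this does not affect the maximum,
   and it makes the set below nonempty for every well-formed digraph. *)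
definition bidirected_clique_number :: "'a pair_pre_digraph \<Rightarrow> nat" where
  "bidirected_clique_number D = Max {card (pverts H) | H. bidirected_clique H D}"

lemma pair_digraph_token_digraph:
  assumes "pair_digraph D"
  shows "pair_digraph (token_digraph k D)"
proof -
  interpret pair_digraph D by fact
  have verts: "finite (pverts (token_digraph k D))"
    using pair_finite_verts by (simp add: token_digraph_def)
  have arc: "fst e \<in> pverts (token_digraph k D) \<and> snd e \<in> pverts (token_digraph k D) \<and> fst e \<noteq> snd e"
    if "e \<in> parcs (token_digraph k D)" for e
  proof -
    obtain A B where e: "e = (A, B)" by (cases e)
    with that obtain a where "A \<in> pverts (token_digraph k D)" "B \<in> pverts (token_digraph k D)"
      "A - B = {a}"
      unfolding token_digraph_def Let_def pair_pre_digraph.simps mem_Collect_eq prod.case by blast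
    moreover from this have "A \<noteq> B" by blast
    ultimately show ?thesis unfolding e by simp
  qed
  have "parcs (token_digraph k D) \<subseteq> pverts (token_digraph k D) \<times> pverts (token_digraph k D)"
  proof
    fix e assume "e \<in> parcs (token_digraph k D)"
    from arc[OF this] show "e \<in> pverts (token_digraph k D) \<times> pverts (token_digraph k D)"
      by (simp add: mem_Times_iff)
  qed
  then have arcs: "finite (parcs (token_digraph k D))"
    by (rule finite_subset) (rule finite_cartesian_product[OF verts verts])
  show ?thesis
  proof
    fix e assume "e \<in> parcs (token_digraph k D)"
    note e = arc[OF this]
    from e show "fst e \<in> pverts (token_digraph k D)" by (rule conjunct1)
    from e show "snd e \<in> pverts (token_digraph k D)" by blast
    from e show "fst e \<noteq> snd e" by blast
  qed (fact verts arcs)+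
qed

lemma finite_bidirected_clique_orders:
  assumes "pair_digraph D"
  shows "finite {card (pverts H) | H. bidirected_clique H D}"
proof -
  interpret pair_digraph D by fact
  have sub: "pverts H \<subseteq> pverts D" if "bidirected_clique H D" for H
    using that unfolding bidirected_clique_def subgraph_def with_proj_simps by blast
  show ?thesis
  proof (rule finite_subset)
    show "{card (pverts H) | H. bidirected_clique H D} \<subseteq> card ` Pow (pverts D)"
      using sub by blast
    show "finite (card ` Pow (pverts D))"
      using pair_finite_verts by (rule finite_imageI[OF finite_Pow_iff[THEN iffD2]])
  qed
qed

end

theory Submission
  imports Defs
begin

text \<open>
  Two \<open>k\<close>-subsets of \<open>V(D)\<close> joined by an arc differ in the exchange of one element. A family of
  sets any two of which differ in this way has one of two shapes: a star, consisting of sets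
  \<open>S \<union> {x}\<close> with a common core \<open>S\<close> of size \<open>k - 1\<close>, or a costar, consisting of sets \<open>T - {x}\<close>
  inside a common \<open>T\<close> of size \<open>k + 1\<close> (\<open>pairwise_exchange_star_or_costar\<close>). In either shape the
  family is parametrised by a set \<open>X\<close> of vertices of \<open>D\<close>, and exchanging \<open>x\<close> for \<open>y\<close> is an arc of
  the token digraph exactly when \<open>x\<close> and \<open>y\<close> are joined in the corresponding direction in \<open>D\<close>. As
  a clique is required to have the arcs in both directions, the family is a bidirected clique iff
  \<open>X\<close> is one (\<open>biclique_star_iff\<close>, \<open>biclique_costar_iff\<close>).

  The only further restriction is room: in a star, \<open>X\<close> avoids \<open>S\<close> and so has at most \<open>n - k + 1\<close>
  elements; in a costar, \<open>X\<close> lies in \<open>T\<close> and so has at most \<open>k + 1\<close>. Conversely, around a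
  clique \<open>X\<close> within one of these bounds a suitable \<open>S\<close> or \<open>T\<close> can be chosen. Hence the orders of
  bidirected cliques of the token digraph are exactly the orders of bidirected cliques of \<open>D\<close>
  that are at most \<open>max (n - k + 1) (k + 1)\<close> (\<open>ex_biclique_token_digraph_iff\<close>).
\<close>

section \<open>Bidirected cliques as vertex sets\<close>

definition biclique_set :: "'a pair_pre_digraph \<Rightarrow> 'a set \<Rightarrow> bool" where
  "biclique_set D K \<longleftrightarrow> K \<subseteq> pverts D \<and> pairwise (\<lambda>x y. (x, y) \<in> parcs D) K"

lemma biclique_set_subset: "biclique_set D K \<Longrightarrow> L \<subseteq> K \<Longrightarrow> biclique_set D L"
  unfolding biclique_set_def by (blast intro: pairwise_subset)

text \<open>
  A complete digraph is determined by its vertices, so the subdigraphs quantified over in the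
  clique number carry no more information than their vertex sets.
\<close>

lemma bidirected_clique_orders:
  assumes "pair_digraph D"
  shows "{card (pverts H) | H. bidirected_clique H D} = card ` {K. biclique_set D K}"
proof -
  interpret pair_digraph D by fact
  have "biclique_set D (pverts H)" if "bidirected_clique H D" for H
    using that
    by (auto simp: bidirected_clique_def complete_digraph_pair_def subgraph_def biclique_set_def
        pairwise_def)
  moreover have "\<exists>H. pverts H = K \<and> bidirected_clique H D" if K: "biclique_set D K" for K
  proof -
    define H where "H = \<lparr>pverts = K, parcs = {(u, v). (u, v) \<in> K \<times> K \<and> u \<noteq> v}\<rparr>"
    have "finite K"
      using K pair_finite_verts by (auto simp: biclique_set_def intro: finite_subset)
    then have "complete_digraph (card K) (with_proj H)"
      by (simp add: complete_digraph_pair_def H_def)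
    moreover have "pair_wf_digraph H"
      by unfold_locales (auto simp: H_def)
    then have "subgraph (with_proj H) (with_proj D)"
      using K wf_digraph
      by (auto simp: subgraph_def compatible_def wf_digraph_wp_iff H_def biclique_set_def
          pairwise_def)
    ultimately have "bidirected_clique H D"
      by (auto simp: bidirected_clique_def)
    moreover have "pverts H = K"
      by (simp add: H_def)
    ultimately show ?thesis by blast
  qed
  ultimately show ?thesis by (force simp: image_iff)
qed

text \<open>
  Subsets of cliques are cliques, so the maximum is characterised by the orders that occur; the
  empty clique takes care of \<open>m = 0\<close>.
\<close>

lemma le_bidirected_clique_number_iff:
  assumes "pair_digraph D"
  shows "m \<le> bidirected_clique_number D \<longleftrightarrow> (\<exists>K. biclique_set D K \<and> card K = m)"
proof -
  let ?O = "card ` {K. biclique_set D K}"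
  have fin: "finite ?O"
    using finite_bidirected_clique_orders[OF assms] by (simp add: bidirected_clique_orders[OF assms])
  have "biclique_set D {}"
    by (simp add: biclique_set_def)
  then have ne: "?O \<noteq> {}" by blast
  have "m \<le> bidirected_clique_number D \<longleftrightarrow> (\<exists>K. biclique_set D K \<and> m \<le> card K)"
    unfolding bidirected_clique_number_def bidirected_clique_orders[OF assms]
    using Max_ge_iff[OF fin ne] by auto
  also have "\<dots> \<longleftrightarrow> (\<exists>K. biclique_set D K \<and> card K = m)"
    by (metis biclique_set_subset obtain_subset_with_card_n order_refl)
  finally show ?thesis .
qed

section \<open>Families of sets that pairwise differ by one exchange\<close>

text \<open>
  Let \<open>A - B = {a}\<close> and \<open>B - A = {b}\<close>. If \<open>C\<close> misses some \<open>s \<in> A \<inter> B\<close>, then \<open>s\<close> is the only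
  element of \<open>A\<close>, and the only one of \<open>B\<close>, that \<open>C\<close> misses; so \<open>C\<close> contains both \<open>a\<close> and \<open>b\<close>.
  If \<open>C'\<close> has some \<open>c \<notin> A \<union> B\<close>, then \<open>c\<close> is the only element of \<open>C'\<close> outside \<open>A\<close>, and the only
  one outside \<open>B\<close>; so \<open>C'\<close> contains neither \<open>a\<close> nor \<open>b\<close>. Such \<open>C\<close> and \<open>C'\<close> cannot both occur
  in \<open>F\<close>, as they differ by more than one exchange.
\<close>

lemma pairwise_exchange_star_or_costar:
  assumes exch: "pairwise (\<lambda>A B. \<exists>a b. A - B = {a} \<and> B - A = {b}) F"
    and "A \<in> F" "B \<in> F" "A \<noteq> B"
  shows "(\<forall>C\<in>F. A \<inter> B \<subseteq> C) \<or> (\<forall>C\<in>F. C \<subseteq> A \<union> B)"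
proof (rule ccontr)
  assume "\<not> ?thesis"
  then obtain C C' s c where C: "C \<in> F" "s \<in> A" "s \<in> B" "s \<notin> C"
    and C': "C' \<in> F" "c \<in> C'" "c \<notin> A" "c \<notin> B"
    by blast
  have diff: "X - Y = {x}" if XY: "X \<in> F" "Y \<in> F" and x: "x \<in> X" "x \<notin> Y" for X Y x
  proof -
    have "X \<noteq> Y" using x by blast
    then obtain x' where "X - Y = {x'}"
      using exch XY unfolding pairwise_def by meson
    then show ?thesis using x by auto
  qed
  obtain a b where ab: "A - B = {a}" "B - A = {b}"
    using exch assms(2-4) unfolding pairwise_def by meson
  have "A - C = {s}" "B - C = {s}"
    using diff C assms(2,3) by simp_all
  then have "a \<in> C" "b \<in> C"
    using ab C by blast+
  moreover have "C' - A = {c}" "C' - B = {c}"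
    using diff C' assms(2,3) by simp_all
  then have "a \<notin> C'" "b \<notin> C'"
    using ab C' by blast+
  ultimately have "C - C' = {a}" "C - C' = {b}"
    using diff[OF C(1) C'(1)] by blast+
  then show False using ab by blast
qed

section \<open>Stars and costars in the token digraph\<close>

lemma token_digraph_verts: "pverts (token_digraph k D) = {A. A \<subseteq> pverts D \<and> card A = k}"
  by (simp add: token_digraph_def)

lemma token_digraph_arc_iff:
  "(A, B) \<in> parcs (token_digraph k D) \<longleftrightarrow>
     A \<in> pverts (token_digraph k D) \<and> B \<in> pverts (token_digraph k D) \<and>
     (\<exists>a b. A - B = {a} \<and> B - A = {b} \<and> (a, b) \<in> parcs D)"
  by (simp add: token_digraph_def)

lemma inj_on_insert: "inj_on (\<lambda>x. insert x S) (- S)"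
  by (auto simp: inj_on_def)

lemma inj_on_remove: "inj_on (\<lambda>x. T - {x}) T"
  by (auto simp: inj_on_def)

lemma biclique_star_iff:
  assumes "finite S" "S \<subseteq> pverts D" "card S + 1 = k" "X \<subseteq> pverts D - S"
  shows "biclique_set (token_digraph k D) ((\<lambda>x. insert x S) ` X) \<longleftrightarrow> biclique_set D X"
proof -
  have verts: "insert x S \<in> pverts (token_digraph k D)" if "x \<in> X" for x
    using assms that by (auto simp: token_digraph_verts)
  have arcs: "(insert x S, insert y S) \<in> parcs (token_digraph k D) \<longleftrightarrow> (x, y) \<in> parcs D"
    and neq: "insert x S \<noteq> insert y S"
    if "x \<in> X" "y \<in> X" "x \<noteq> y" for x y
  proof -
    have d: "insert x S - insert y S = {x}" "insert y S - insert x S = {y}"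
      using assms that by auto
    show "(insert x S, insert y S) \<in> parcs (token_digraph k D) \<longleftrightarrow> (x, y) \<in> parcs D"
      unfolding token_digraph_arc_iff d using verts that by auto
    show "insert x S \<noteq> insert y S" using d by blast
  qed
  show ?thesis
    using verts arcs neq assms(4)
    unfolding biclique_set_def pairwise_image by (auto simp: pairwise_def)
qed

text \<open>
  Exchanging here reverses the arcs: passing from \<open>T - {x}\<close> to \<open>T - {y}\<close> moves a token from \<open>y\<close> to
  \<open>x\<close>. For bidirected cliques this makes no difference.
\<close>

lemma biclique_costar_iff:
  assumes "finite T" "T \<subseteq> pverts D" "card T = k + 1" "X \<subseteq> T"
  shows "biclique_set (token_digraph k D) ((\<lambda>x. T - {x}) ` X) \<longleftrightarrow> biclique_set D X"
proof -
  have verts: "T - {x} \<in> pverts (token_digraph k D)" if "x \<in> X" for x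
    using assms that by (auto simp: token_digraph_verts card_Diff_singleton subset_iff)
  have arcs: "(T - {x}, T - {y}) \<in> parcs (token_digraph k D) \<longleftrightarrow> (y, x) \<in> parcs D"
    and neq: "T - {x} \<noteq> T - {y}"
    if "x \<in> X" "y \<in> X" "x \<noteq> y" for x y
  proof -
    have d: "T - {x} - (T - {y}) = {y}" "T - {y} - (T - {x}) = {x}"
      using assms that by auto
    show "(T - {x}, T - {y}) \<in> parcs (token_digraph k D) \<longleftrightarrow> (y, x) \<in> parcs D"
      unfolding token_digraph_arc_iff d using verts that by auto
    show "T - {x} \<noteq> T - {y}" using d by blast
  qed
  show ?thesis
    using verts arcs neq assms(2,4)
    unfolding biclique_set_def pairwise_image by (auto simp: pairwise_def)
qed

section \<open>Cliques of the token digraph\<close>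

lemma biclique_token_digraph_cases:
  assumes "finite (pverts D)" "1 \<le> k"
    and F: "biclique_set (token_digraph k D) F" "F \<noteq> {}"
  obtains (star) S X where "S \<subseteq> pverts D" "card S + 1 = k" "X \<subseteq> pverts D - S"
      "F = (\<lambda>x. insert x S) ` X"
    | (costar) T X where "T \<subseteq> pverts D" "card T = k + 1" "X \<subseteq> T" "F = (\<lambda>x. T - {x}) ` X"
proof -
  have tok: "A \<subseteq> pverts D" "finite A" "card A = k" if "A \<in> F" for A
    using F(1) that assms(1) by (auto simp: biclique_set_def token_digraph_verts intro: finite_subset)
  have exch: "pairwise (\<lambda>A B. \<exists>a b. A - B = {a} \<and> B - A = {b}) F"
    using F(1) unfolding biclique_set_def
    by (elim conjE pairwise_mono) (auto simp: token_digraph_arc_iff)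
  \<comment> \<open>By cardinality alone, a core or an envelope of the right size determines the whole shape.\<close>
  have star': thesis if S: "S \<subseteq> pverts D" "card S + 1 = k" "\<forall>C\<in>F. S \<subseteq> C" for S
  proof (rule star)
    have fS: "finite S" using S(1) assms(1) finite_subset by blast
    have "\<exists>x. x \<in> pverts D - S \<and> C = insert x S" if "C \<in> F" for C
    proof -
      have "card (C - S) = 1"
        using S fS tok[OF that] that by (subst card_Diff_subset) auto
      then obtain x where "C - S = {x}" by (auto simp: card_1_singleton_iff)
      then show ?thesis using S(3) tok[OF that] that by blast
    qed
    then show "F = (\<lambda>x. insert x S) ` {x \<in> pverts D - S. insert x S \<in> F}" by blast
  qed (use S in auto)
  have costar': thesis if T: "T \<subseteq> pverts D" "card T = k + 1" "\<forall>C\<in>F. C \<subseteq> T" for T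
  proof (rule costar)
    have "\<exists>x\<in>T. C = T - {x}" if "C \<in> F" for C
    proof -
      have "card (T - C) = 1"
        using T tok[OF that] that by (subst card_Diff_subset) auto
      then obtain x where "T - C = {x}" by (auto simp: card_1_singleton_iff)
      then show ?thesis using T(3) that by blast
    qed
    then show "F = (\<lambda>x. T - {x}) ` {x \<in> T. T - {x} \<in> F}" by blast
  qed (use T in auto)
  obtain A where A: "A \<in> F" using F(2) by blast
  show thesis
  proof (cases "F = {A}")
    case True
    \<comment> \<open>A single token set is a star around any of its \<open>(k - 1)\<close>-subsets.\<close>
    obtain a where "a \<in> A" using tok[OF A] assms(2) by fastforce
    then show thesis
      using tok[OF A] assms(2) True by (intro star'[of "A - {a}"]) auto
  next
    case False
    then obtain B where B: "B \<in> F" "A \<noteq> B" using A by blast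
    obtain a b where ab: "A - B = {a}" "B - A = {b}"
      using exch A B unfolding pairwise_def by meson
    have "A \<inter> B = A - {a}" "a \<in> A" "A \<union> B = insert b A" "b \<notin> A"
      using ab by blast+
    then have cards: "card (A \<inter> B) + 1 = k" "card (A \<union> B) = k + 1"
      using tok[OF A] assms(2) by auto
    from pairwise_exchange_star_or_costar[OF exch A B] show thesis
      using star'[of "A \<inter> B"] costar'[of "A \<union> B"] cards tok(1)[OF A] tok(1)[OF B(1)] by blast
  qed
qed

text \<open>
  Equivalence for each order \<open>m\<close> separately, so that no optimal clique has to be handled. In a
  star of order \<open>m\<close> the core and the clique are disjoint, which needs \<open>(k - 1) + m \<le> n\<close>. In a
  costar, \<open>k + 1 \<le> n\<close> ensures that a clique on at most \<open>k + 1\<close> vertices extends to a set \<open>T\<close> of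
  that size.
\<close>

lemma ex_biclique_token_digraph_iff:
  assumes D: "pair_digraph D" and n: "card (pverts D) = n" and k: "1 \<le> k" "k \<le> n - 1"
  shows "(\<exists>F. biclique_set (token_digraph k D) F \<and> card F = m) \<longleftrightarrow>
         (\<exists>K. biclique_set D K \<and> card K = m) \<and> m \<le> max (n - k + 1) (k + 1)"
    (is "?L \<longleftrightarrow> ?R")
proof -
  interpret pair_digraph D by fact
  note fin = pair_finite_verts
  have finV: "finite S" if "S \<subseteq> pverts D" for S
    using fin that finite_subset by blast
  show ?thesis
  proof
    assume ?L
    then obtain F where F: "biclique_set (token_digraph k D) F" "card F = m" by blast
    show ?R
    proof (cases "F = {}")
      case True
      then have "biclique_set D {} \<and> card ({} :: 'a set) = m"
        using F by (simp add: biclique_set_def)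
      then show ?thesis using True F by auto
    next
      case False
      from fin k(1) F(1) False show ?thesis
      proof (cases rule: biclique_token_digraph_cases)
        case (star S X)
        have "card X = m"
          using star F(2) by (subst F(2)[symmetric]) (auto intro!: card_image[symmetric]
              inj_on_subset[OF inj_on_insert])
        moreover have "biclique_set D X"
          using F(1) biclique_star_iff[OF finV] star by metis
        moreover have "card X \<le> card (pverts D - S)"
          using star fin by (intro card_mono) auto
        then have "card X \<le> n - k + 1"
          using star finV n k by (simp add: card_Diff_subset)
        ultimately show ?thesis by auto
      next
        case (costar T X)
        have "card X = m"
          using costar F(2) by (subst F(2)[symmetric]) (auto intro!: card_image[symmetric]
              inj_on_subset[OF inj_on_remove])
        moreover have "biclique_set D X"
          using F(1) biclique_costar_iff[OF finV] costar by metis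
        moreover have "card X \<le> k + 1"
          using costar finV card_mono by metis
        ultimately show ?thesis by auto
      qed
    qed
  next
    assume ?R
    then obtain K where K: "biclique_set D K" "card K = m"
      and m: "m \<le> n - k + 1 \<or> m \<le> k + 1" unfolding le_max_iff_disj by blast
    have KV: "K \<subseteq> pverts D" using K by (simp add: biclique_set_def)
    from m show ?L
    proof
      assume "m \<le> n - k + 1"
      then have "k - 1 \<le> card (pverts D - K)"
        using KV finV K n k by (simp add: card_Diff_subset)
      then obtain S where S: "S \<subseteq> pverts D - K" "card S = k - 1"
        by (meson obtain_subset_with_card_n)
      then have "biclique_set (token_digraph k D) ((\<lambda>x. insert x S) ` K)"
        using KV K k finV by (subst biclique_star_iff) auto
      moreover have "card ((\<lambda>x. insert x S) ` K) = m"
        using S K by (subst card_image) (auto intro!: inj_on_subset[OF inj_on_insert])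
      ultimately show ?L by blast
    next
      assume "m \<le> k + 1"
      moreover have "k + 1 \<le> card (pverts D)" using n k by linarith
      ultimately obtain T where T: "K \<subseteq> T" "T \<subseteq> pverts D" "card T = k + 1"
        using exists_subset_between[of K "k + 1" "pverts D"] KV K fin by auto
      then have "biclique_set (token_digraph k D) ((\<lambda>x. T - {x}) ` K)"
        using K finV by (subst biclique_costar_iff) auto
      moreover have "card ((\<lambda>x. T - {x}) ` K) = m"
        using T K by (subst card_image) (auto intro!: inj_on_subset[OF inj_on_remove])
      ultimately show ?L by blast
    qed
  qed
qed

theorem theorem8p2:
  fixes D :: "'a pair_pre_digraph" and n k :: nat
  assumes "pair_digraph D"
    and "card (pverts D) = n"
    and "1 \<le> k" and "k \<le> n - 1"
  shows "bidirected_clique_number (token_digraph k D)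
           = min (bidirected_clique_number D) (max (n - k + 1) (k + 1))"
proof -
  have "m \<le> bidirected_clique_number (token_digraph k D) \<longleftrightarrow>
      m \<le> min (bidirected_clique_number D) (max (n - k + 1) (k + 1))" for m
    unfolding le_bidirected_clique_number_iff[OF pair_digraph_token_digraph[OF assms(1)]]
      min.bounded_iff le_bidirected_clique_number_iff[OF assms(1)]
    by (rule ex_biclique_token_digraph_iff[OF assms])
  then show ?thesis by (intro order_antisym) blast+
qed

end
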